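(* Let $R$ be a 2-Henselian valuation ring with $v(2)>0$. The generalized Arf invariant is an invariant of the isomorphism class of $M_{\alpha,\beta}$. That is, if $M_{\alpha,\beta}$ and $M_{\gamma,\delta}$ are isomorphic lattices, with $v(\alpha)\leq v(\beta)$, $v(\gamma)\leq v(\delta)$, with $\beta$ and $\delta$ of maximal valuation, and for which the generalized Arf invariant is defined, then their generalized Arf invariants coincide.
   Context: A valuation ring $R$ is an integral domain with fraction field $\mathbb{K}$, a totally ordered abelian group $\Gamma$ (additive, arbitrary rank) and a surjective homomorphism $v:\mathbb{K}^{*}\to\Gamma$ with $v(x+y)\geq\min\{v(x),v(y)\}$, extended by $v(0)=\infty$, such that $R=\{x\in\mathbb{K}: v(x)\geq0\}$. For $\gamma\in\Gamma$, $I_{\gamma}=\{x\in\mathbb{K}: v(x)>\gamma\}$; $I_{0}$ is the maximal ideal. $R$ is 2-Henselian if $2\neq0$ in $R$ and for every monic $f\in R[x]$ of degree 2 and every $a\in R$ with $v(f(a))>0$ and $v(f'(a))=0$ there is a root $b\in R$ of $f$ with $b-a\in I_{0}$. For $\alpha,\beta\in R$, $M_{\alpha,\beta}$ is the free rank 2 $R$-module with basis $x,y$ and symmetric bilinear form given by $x^{2}=(x,x)=\alpha$, $(x,y)=1$, $y^{2}=(y,y)=\beta$; isomorphisms are $R$-linear bijections preserving the form. The norm of $z$ is $z^{2}=(z,z)$. An element $z\in M$ is primitive if $M/Rz$ is torsion-free. "$\beta$ has maximal valuation" means that $v(\beta)\geq v(z^{2})$ for every primitive $z\in M_{\alpha,\beta}$.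 A lattice is isotropic if it contains a non-zero vector of norm 0. An element of $\Gamma$ is even if it is divisible by 2 in $\Gamma$, and odd otherwise. An element $a\in R$ of even valuation is an approximate square if $a-b^{2}\in I_{v(a)}$ for some $b\in R$. For even $u$, $J_{u}$ is the union of $I_{u}$ with the set of approximate squares of valuation $u$; it is an additive subgroup of $R$. Put $\rho(x)=x^{2}-x$ and $R_{AS}=\rho(R)$ (an additive subgroup of $R$ when $R$ is 2-Henselian with $v(2)>0$). Generalized Arf invariant of $M_{\alpha,\beta}$ (with $v(\alpha)\leq v(\beta)$ and $\beta$ of maximal valuation): (1) if $M_{\alpha,\beta}$ is isotropic (i.e. $\beta=0$), it is 0 ("vanishing"); (2) if $v(\alpha)+v(\beta)<2v(2)$ is odd, it is the class $\alpha\beta+I_{v(\alpha\beta)}$ ("odd"); (3) if $0<v(\alpha)+v(\beta)<2v(2)$ is even, it is the class $\alpha\beta+J_{v(\alpha\beta)}$ ("even"); (4) if $v(\alpha)+v(\beta)=2v(2)$, it is the image of $\alpha\beta$ in $4R/4R_{AS}$ ("exact"). If $\beta$ has maximal valuation then $v(\alpha)+v(\beta)>2v(2)$ only if $\beta=0$, so these cases cover everything except $v(\alpha)=v(\beta)=0$, where the invariant is not defined. Coincidence of invariants means that they are of the same type (the same group being used as modulus) and are the same class. *)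

theory Defs
  imports
    "HOL-Computational_Algebra.Polynomial"
    "HOL-Library.Extended"
    "HOL-Library.Product_Plus"
begin

section \<open>Valuations and valuation rings\<close>

text \<open>
  The field is the type \<open>'k\<close>, the value group the type \<open>'g\<close> (a totally ordered abelian group of
  arbitrary rank). Values lie in \<open>'g extended\<close>, where \<open>Pinf\<close> is the value of \<open>0\<close>; the element
  \<open>Minf\<close> of that type is never a value.
\<close>

locale valuation =
  fixes v :: "'k::field \<Rightarrow> 'g::linordered_ab_group_add extended"
  assumes v_zero: "v 0 = Pinf"
    and v_nonzero: "x \<noteq> 0 \<Longrightarrow> v x \<in> range Fin"
    and v_mult: "x \<noteq> 0 \<Longrightarrow> y \<noteq> 0 \<Longrightarrow> v (x * y) = v x + v y"
    and v_add: "min (v x) (v y) \<le> v (x + y)"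
    and v_surj: "\<exists>x. x \<noteq> 0 \<and> v x = Fin \<gamma>"

definition val_ring :: "('k::field \<Rightarrow> 'g::linordered_ab_group_add extended) \<Rightarrow> 'k set"
  where "val_ring v = {x. 0 \<le> v x}"

definition val_ideal :: "('k::field \<Rightarrow> 'g::linordered_ab_group_add extended) \<Rightarrow> 'g extended \<Rightarrow> 'k set"
  where "val_ideal v \<gamma> = {x. \<gamma> < v x}"

definition two_henselian :: "('k::field \<Rightarrow> 'g::linordered_ab_group_add extended) \<Rightarrow> bool"
  where "two_henselian v \<longleftrightarrow>
    (2::'k) \<noteq> 0 \<and>
    (\<forall>f. lead_coeff f = 1 \<and> degree f = 2 \<and> (\<forall>i. coeff f i \<in> val_ring v) \<longrightarrow>
      (\<forall>a\<in>val_ring v. 0 < v (poly f a) \<and> v (poly (pderiv f) a) = 0 \<longrightarrow>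
        (\<exists>b\<in>val_ring v. poly f b = 0 \<and> b - a \<in> val_ideal v 0)))"

section \<open>The lattice with basis of norms \<open>\<alpha>\<close> and \<open>\<beta>\<close>\<close>

text \<open>
  With \<open>R = val_ring v\<close>, the underlying module of every \<open>M\<^bsub>\<alpha>,\<beta>\<^esub>\<close> is \<open>R \<times> R\<close>, where \<open>(a, b)\<close> stands
  for \<open>a x + b y\<close>; only the form depends on \<open>\<alpha>\<close> and \<open>\<beta>\<close>.
\<close>

definition lattice :: "('k::field \<Rightarrow> 'g::linordered_ab_group_add extended) \<Rightarrow> ('k \<times> 'k) set"
  where "lattice v = val_ring v \<times> val_ring v"

definition scale :: "'k::field \<Rightarrow> 'k \<times> 'k \<Rightarrow> 'k \<times> 'k"
  where "scale r z = (r * fst z, r * snd z)"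

definition form :: "'k::field \<Rightarrow> 'k \<Rightarrow> 'k \<times> 'k \<Rightarrow> 'k \<times> 'k \<Rightarrow> 'k"
  where "form \<alpha> \<beta> z w =
    \<alpha> * (fst z * fst w) + (fst z * snd w + snd z * fst w) + \<beta> * (snd z * snd w)"

definition lattice_iso ::
  "('k::field \<Rightarrow> 'g::linordered_ab_group_add extended) \<Rightarrow> 'k \<Rightarrow> 'k \<Rightarrow> 'k \<Rightarrow> 'k
    \<Rightarrow> ('k \<times> 'k \<Rightarrow> 'k \<times> 'k) \<Rightarrow> bool"
  where "lattice_iso v \<alpha> \<beta> \<gamma> \<delta> \<phi> \<longleftrightarrow>
    bij_betw \<phi> (lattice v) (lattice v) \<and>
    (\<forall>z\<in>lattice v. \<forall>w\<in>lattice v. \<phi> (z + w) = \<phi> z + \<phi> w) \<and>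
    (\<forall>r\<in>val_ring v. \<forall>z\<in>lattice v. \<phi> (scale r z) = scale r (\<phi> z)) \<and>
    (\<forall>z\<in>lattice v. \<forall>w\<in>lattice v. form \<gamma> \<delta> (\<phi> z) (\<phi> w) = form \<alpha> \<beta> z w)"

definition isomorphic_lattices ::
  "('k::field \<Rightarrow> 'g::linordered_ab_group_add extended) \<Rightarrow> 'k \<Rightarrow> 'k \<Rightarrow> 'k \<Rightarrow> 'k \<Rightarrow> bool"
  where "isomorphic_lattices v \<alpha> \<beta> \<gamma> \<delta> \<longleftrightarrow> (\<exists>\<phi>. lattice_iso v \<alpha> \<beta> \<gamma> \<delta> \<phi>)"

definition span1 ::
  "('k::field \<Rightarrow> 'g::linordered_ab_group_add extended) \<Rightarrow> 'k \<times> 'k \<Rightarrow> ('k \<times> 'k) set"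
  where "span1 v z = {scale r z | r. r \<in> val_ring v}"

text \<open>
  The last conjunct says that \<open>M / R z\<close> is torsion-free. The zero vector is excluded explicitly:
  \<open>M / 0\<close> is torsion-free too, but if \<open>0\<close> were primitive then only \<open>\<beta> = 0\<close> could have maximal
  valuation.
\<close>

definition primitive ::
  "('k::field \<Rightarrow> 'g::linordered_ab_group_add extended) \<Rightarrow> 'k \<times> 'k \<Rightarrow> bool"
  where "primitive v z \<longleftrightarrow>
    z \<in> lattice v \<and> z \<noteq> 0 \<and>
    (\<forall>w\<in>lattice v. \<forall>r\<in>val_ring v. r \<noteq> 0 \<and> scale r w \<in> span1 v z \<longrightarrow> w \<in> span1 v z)"

definition maximal_valuation ::
  "('k::field \<Rightarrow> 'g::linordered_ab_group_add extended) \<Rightarrow> 'k \<Rightarrow> 'k \<Rightarrow> bool"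
  where "maximal_valuation v \<alpha> \<beta> \<longleftrightarrow> (\<forall>z. primitive v z \<longrightarrow> v (form \<alpha> \<beta> z z) \<le> v \<beta>)"

definition isotropic ::
  "('k::field \<Rightarrow> 'g::linordered_ab_group_add extended) \<Rightarrow> 'k \<Rightarrow> 'k \<Rightarrow> bool"
  where "isotropic v \<alpha> \<beta> \<longleftrightarrow> (\<exists>z\<in>lattice v. z \<noteq> 0 \<and> form \<alpha> \<beta> z z = 0)"

section \<open>The generalized Arf invariant\<close>

definition even_value :: "'g::linordered_ab_group_add extended \<Rightarrow> bool"
  where "even_value u \<longleftrightarrow> (\<exists>\<gamma>. u = Fin (\<gamma> + \<gamma>))"

definition odd_value :: "'g::linordered_ab_group_add extended \<Rightarrow> bool"
  where "odd_value u \<longleftrightarrow> (\<exists>\<gamma>. u = Fin \<gamma> \<and> \<not> (\<exists>\<delta>. \<gamma> = \<delta> + \<delta>))"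

definition approx_square :: "('k::field \<Rightarrow> 'g::linordered_ab_group_add extended) \<Rightarrow> 'k \<Rightarrow> bool"
  where "approx_square v a \<longleftrightarrow>
    a \<in> val_ring v \<and> even_value (v a) \<and> (\<exists>b\<in>val_ring v. a - b\<^sup>2 \<in> val_ideal v (v a))"

definition approx_square_group ::
  "('k::field \<Rightarrow> 'g::linordered_ab_group_add extended) \<Rightarrow> 'g extended \<Rightarrow> 'k set"  \<comment> \<open>\<open>J\<^sub>u\<close>\<close>
  where "approx_square_group v u = val_ideal v u \<union> {a. approx_square v a \<and> v a = u}"

definition artin_schreier_group ::
  "('k::field \<Rightarrow> 'g::linordered_ab_group_add extended) \<Rightarrow> 'k set"  \<comment> \<open>\<open>R\<^sub>A\<^sub>S\<close>\<close>
  where "artin_schreier_group v = (\<lambda>x. x\<^sup>2 - x) ` val_ring v"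

text \<open>
  The two arguments of \<open>Odd_Arf\<close>, \<open>Even_Arf\<close> and \<open>Exact_Arf\<close> are the group used as modulus and the
  class, a coset of that group. So two values are equal iff they have the same type, the same
  modulus and the same class.
\<close>

datatype 'k arf_invariant =
    Vanishing_Arf
  | Odd_Arf "'k set" "'k set"
  | Even_Arf "'k set" "'k set"
  | Exact_Arf "'k set" "'k set"

definition coset :: "'k::field \<Rightarrow> 'k set \<Rightarrow> 'k set"
  where "coset a H = {a + h | h. h \<in> H}"

text \<open>
  \<open>None\<close> means that the invariant is not defined. The definition is only meaningful if
  \<open>v \<alpha> \<le> v \<beta>\<close> and \<open>\<beta>\<close> has maximal valuation. The value \<open>2 v(2)\<close> is written \<open>v 2 + v 2\<close>.
\<close>

definition arf ::
  "('k::field \<Rightarrow> 'g::linordered_ab_group_add extended) \<Rightarrow> 'k \<Rightarrow> 'k \<Rightarrow> 'k arf_invariant option"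
  where "arf v \<alpha> \<beta> =
   (let s = v \<alpha> + v \<beta>; t = v 2 + v 2; d = \<alpha> * \<beta>;
        I = val_ideal v (v d); J = approx_square_group v (v d);
        E = (\<lambda>x. 4 * x) ` artin_schreier_group v
    in if isotropic v \<alpha> \<beta> then Some Vanishing_Arf
       else if s < t \<and> odd_value s then Some (Odd_Arf I (coset d I))
       else if 0 < s \<and> s < t \<and> even_value s then Some (Even_Arf J (coset d J))
       else if s = t then Some (Exact_Arf E (coset d E))
       else None)"

end

theory Submission
  imports Defs
begin

text \<open>
  Let \<open>X = a x + b y\<close>, \<open>Y = c x + d y\<close> be the basis of \<open>M\<^bsub>\<alpha>,\<beta>\<^esub>\<close> that corresponds to the standard basis
  of \<open>M\<^bsub>\<gamma>,\<delta>\<^esub>\<close> under an isomorphism, so \<open>X\<^sup>2 = \<gamma>\<close>, \<open>Y\<^sup>2 = \<delta>\<close> and \<open>(X, Y) = 1\<close>.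

  Isotropy is clearly invariant. In the anisotropic case, the type of the invariant depends only on
  \<open>v (\<alpha> \<beta>)\<close>. Now \<open>v \<beta>\<close> is the largest value of a primitive norm
  (\<open>isomorphic_maximal_valuation_le\<close>). Moreover \<open>v \<alpha> \<le> v \<beta>\<close> and \<open>v (\<alpha> \<beta>) \<le> 2 v(2)\<close> force \<open>v \<alpha> \<le> v 2\<close>, so \<open>v \<alpha>\<close>
  is the smallest value of any norm (\<open>norm_ge\<close>). Hence \<open>v \<alpha> = v \<gamma>\<close> and \<open>v \<beta> = v \<delta>\<close>, and both invariants
  are classes for the same modulus.

  It remains to compare the classes. Taking Gram determinants gives \<open>\<gamma> \<delta> - 1 = D\<^sup>2 (\<alpha> \<beta> - 1)\<close>
  with \<open>D = a d - b c = 1 + \<epsilon>\<close>, that is,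
  \<open>\<gamma> \<delta> - \<alpha> \<beta> = (2 \<epsilon> + \<epsilon>\<^sup>2) (\<alpha> \<beta> - 1)\<close>. The heart of the proof is \<open>change_of_basis\<close>: because \<open>Y\<close> has norm of
  value \<open>v \<beta>\<close>, its first coordinate is small (\<open>first_coordinate_bound\<close>), and then \<open>(X, Y) = 1\<close> gives
  \<open>v (\<epsilon>\<^sup>2) \<ge> v (\<alpha> \<beta>)\<close>. The three types now follow (\<open>arf_eqI\<close>).
  If \<open>v (\<alpha> \<beta>) < 2 v(2)\<close>, then \<open>2 \<epsilon>\<close> has value greater than \<open>v (\<alpha> \<beta>)\<close>, so only \<open>\<epsilon>\<^sup>2\<close> matters: for odd
  \<open>v (\<alpha> \<beta>)\<close> it has greater value as well, and for even \<open>v (\<alpha> \<beta>)\<close> it is a square, which the modulus absorbs.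
  If \<open>v (\<alpha> \<beta>) = 2 v(2)\<close>, then \<open>\<epsilon> = 2 \<eta>\<close> with \<open>\<eta>\<close> in the ring, and \<open>(\<gamma> \<delta> - \<alpha> \<beta>) / 4\<close> is congruent to
  \<open>- (\<eta>\<^sup>2 + \<eta>)\<close>, hence to \<open>\<eta>\<^sup>2 - \<eta>\<close>, modulo the maximal ideal; Hensel's property makes it an exact
  Artin--Schreier value (\<open>artin_schreier_groupI\<close>).
\<close>

section \<open>Computing with values\<close>

context valuation
begin

lemma v_not_Minf: "v x \<noteq> Minf"
  using v_zero v_nonzero[of x] by (cases "x = 0") auto

lemma v_eq_Pinf_iff: "v x = Pinf \<longleftrightarrow> x = 0"
  using v_zero v_nonzero[of x] by (cases "x = 0") auto

lemma v_nonzeroE: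
  assumes "x \<noteq> 0"
  obtains \<gamma> where "v x = Fin \<gamma>"
  using v_nonzero[OF assms] by auto

lemma v_times: "v (x * y) = v x + v y"
proof (cases "x = 0 \<or> y = 0")
  case True
  then show ?thesis
    using v_not_Minf[of x] v_not_Minf[of y] by (cases "v x"; cases "v y") (auto simp: v_zero)
qed (simp add: v_mult)

lemma v_square: "v (x\<^sup>2) = v x + v x"
  by (simp add: power2_eq_square v_times)

text \<open>
  Comparing squares replaces division by 2 in the value group, which is not always possible: a bound
  on \<open>v (x\<^sup>2)\<close> is used where one would like to bound \<open>v x\<close> by half of some value.
\<close>

lemma v_square_le_iff: "v (x\<^sup>2) \<le> v (y\<^sup>2) \<longleftrightarrow> v x \<le> v y"
proof -
  have "g + g \<le> h + h \<longleftrightarrow> g \<le> h" for g h :: 'g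
    by (metis add_mono add_strict_mono not_le)
  then show ?thesis
    using v_not_Minf[of x] v_not_Minf[of y] unfolding v_square
    by (cases "v x"; cases "v y") auto
qed

lemma v_square_less_iff: "v (x\<^sup>2) < v (y\<^sup>2) \<longleftrightarrow> v x < v y"
  using v_square_le_iff[of y x] by (simp add: not_le[symmetric])

lemma v_times_le_cancel: "z \<noteq> 0 \<Longrightarrow> v (z * x) \<le> v (z * y) \<longleftrightarrow> v x \<le> v y"
  using v_not_Minf[of x] v_not_Minf[of y] unfolding v_times
  by (erule_tac v_nonzeroE, cases "v x"; cases "v y") auto

lemma v_times_less_cancel: "z \<noteq> 0 \<Longrightarrow> v (z * x) < v (z * y) \<longleftrightarrow> v x < v y"
  using v_times_le_cancel[of z y x] by (simp add: not_le[symmetric])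

lemma v_one: "v 1 = 0"
proof -
  obtain g where g: "v 1 = Fin g"
    by (rule v_nonzeroE[of 1]) auto
  then show ?thesis
    using v_times[of 1 1] by (simp add: zero_extended_def)
qed

lemma v_uminus: "v (- x) = v x"
proof -
  have "v ((- x)\<^sup>2) = v (x\<^sup>2)" by simp
  then show ?thesis
    using v_square_le_iff[of x "- x"] v_square_le_iff[of "- x" x] by force
qed

lemma v_add_ge: "u \<le> v x \<Longrightarrow> u \<le> v y \<Longrightarrow> u \<le> v (x + y)"
  using v_add[of x y] by (auto simp: min_def split: if_splits)

lemma v_add_gt: "u < v x \<Longrightarrow> u < v y \<Longrightarrow> u < v (x + y)"
  using v_add[of x y] by (auto simp: min_def split: if_splits)

lemma v_diff_ge: "u \<le> v x \<Longrightarrow> u \<le> v y \<Longrightarrow> u \<le> v (x - y)"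
  using v_add_ge[of u x "- y"] by (simp add: v_uminus)

lemma v_diff_gt: "u < v x \<Longrightarrow> u < v y \<Longrightarrow> u < v (x - y)"
  using v_add_gt[of u x "- y"] by (simp add: v_uminus)

lemma v_times_ge: "u \<le> v x \<Longrightarrow> 0 \<le> v r \<Longrightarrow> u \<le> v (x * r)"
  using add_mono[of u "v x" 0 "v r"] by (simp add: v_times)

lemma v_times_gt: "u < v x \<Longrightarrow> 0 \<le> v r \<Longrightarrow> u < v (x * r)"
  using v_times_ge[of "v x" x r] by (simp add: less_le_trans)

lemma v_square_nonneg_iff: "0 \<le> v (x\<^sup>2) \<longleftrightarrow> 0 \<le> v x"
  using v_square_le_iff[of 1 x] by (simp add: v_one)

lemma v_square_pos_iff: "0 < v (x\<^sup>2) \<longleftrightarrow> 0 < v x"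
  using v_square_less_iff[of 1 x] by (simp add: v_one)

text \<open>
  The elements whose square has value at least \<open>u\<close> form a group. The cross term of \<open>(x + y)\<^sup>2\<close>
  need not be treated: the sum has at least the value of one of the summands.
\<close>

lemma v_square_add_ge:
  assumes "u \<le> v (x\<^sup>2)" "u \<le> v (y\<^sup>2)"
  shows "u \<le> v ((x + y)\<^sup>2)"
proof -
  have "v x \<le> v (x + y) \<or> v y \<le> v (x + y)"
    using v_add[of x y] by (auto simp: min_def split: if_splits)
  then show ?thesis
    using assms v_square_le_iff order_trans by metis
qed

lemma v_four: "v 4 = v 2 + v 2"
  using v_square[of 2] by simp

lemma v_two_nonneg: "0 \<le> v 2"
  using v_add_ge[of 0 1 1] by (simp add: v_one)

lemma val_ring_iff: "x \<in> val_ring v \<longleftrightarrow> 0 \<le> v x"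
  by (simp add: val_ring_def)

lemma val_ring_closed:
  assumes "0 \<le> v x" "0 \<le> v y"
  shows "0 \<le> v (x + y)" "0 \<le> v (x - y)" "0 \<le> v (x * y)"
  using assms by (auto intro: v_add_ge v_diff_ge v_times_ge simp: v_uminus)

end

section \<open>The moduli\<close>

lemma coset_eqI:
  assumes add: "\<And>x y. x \<in> H \<Longrightarrow> y \<in> H \<Longrightarrow> x + y \<in> H"
    and neg: "\<And>x. x \<in> H \<Longrightarrow> - x \<in> H"
    and diff: "b - a \<in> H"
  shows "coset a H = coset b H"
proof -
  have "coset c H \<subseteq> coset d H" if "c - d \<in> H" for c d
  proof
    fix x assume "x \<in> coset c H"
    then obtain h where "h \<in> H" "x = c + h" by (auto simp: coset_def)
    then have "x = d + ((c - d) + h)" "(c - d) + h \<in> H" using add that by auto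
    then show "x \<in> coset d H" unfolding coset_def by blast
  qed
  moreover have "a - b \<in> H" using neg[OF diff] by simp
  ultimately show ?thesis using diff by blast
qed

context valuation
begin

lemma coset_val_ideal_eqI:
  assumes "b - a \<in> val_ideal v u"
  shows "coset a (val_ideal v u) = coset b (val_ideal v u)"
  using assms by (intro coset_eqI) (auto simp: val_ideal_def v_add_gt v_uminus)

text \<open>
  This form treats the two parts of \<open>J\<^sub>u\<close> alike; elements of \<open>I\<^sub>u\<close> are approximated by the square
  of 0.
\<close>

lemma approx_square_group_iff:
  assumes u: "even_value u" "0 \<le> u"
  shows "x \<in> approx_square_group v u \<longleftrightarrow> (\<exists>b. u \<le> v (b\<^sup>2) \<and> u < v (x - b\<^sup>2))"
proof
  assume "x \<in> approx_square_group v u"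
  then consider "u < v x" | b where "v x = u" "u < v (x - b\<^sup>2)"
    by (auto simp: approx_square_group_def approx_square_def val_ideal_def)
  then show "\<exists>b. u \<le> v (b\<^sup>2) \<and> u < v (x - b\<^sup>2)"
  proof cases
    case 1
    then show ?thesis by (intro exI[of _ 0]) (simp add: v_zero)
  next
    case 2
    then have "u \<le> v (x - (x - b\<^sup>2))" using v_diff_ge[of u x "x - b\<^sup>2"] by simp
    with 2 show ?thesis by auto
  qed
next
  assume "\<exists>b. u \<le> v (b\<^sup>2) \<and> u < v (x - b\<^sup>2)"
  then obtain b where b: "u \<le> v (b\<^sup>2)" "u < v (x - b\<^sup>2)" by blast
  have "u \<le> v x" using v_add_ge[of u "b\<^sup>2" "x - b\<^sup>2"] b by simp
  moreover have "0 \<le> v b" using u(2) b(1) v_square_nonneg_iff by force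
  ultimately show "x \<in> approx_square_group v u"
    using u b
    by (auto simp: approx_square_group_def approx_square_def val_ideal_def val_ring_iff)
qed

lemma two_times_square_gt:
  assumes "0 < v 2" "u = Fin \<gamma>" "u \<le> v b" "u \<le> v c"
  shows "Fin (\<gamma> + \<gamma>) < v (2 * (b * c))"
proof -
  have "Fin (\<gamma> + \<gamma>) \<le> v (b * c)"
    using assms(2) add_mono[OF assms(3,4)] by (simp add: v_times)
  then show ?thesis
    using assms(1) v_not_Minf[of "b * c"] v_not_Minf[of 2]
    unfolding v_times[of 2] zero_extended_def
    by (cases "v 2"; cases "v (b * c)") (auto simp: add_strict_increasing)
qed

text \<open>
  \<open>J\<^sub>u\<close> is a group, since modulo \<open>I\<^sub>u\<close> squaring is additive on elements whose square has
  value at least \<open>u\<close>: the error terms \<open>2 r s\<close> and \<open>2 r\<^sup>2\<close> are in \<open>I\<^sub>u\<close> because \<open>v 2 > 0\<close>.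
\<close>

lemma coset_approx_square_group_eqI:
  assumes two: "0 < v 2" and u: "even_value u" "0 \<le> u"
    and diff: "b - a \<in> approx_square_group v u"
  shows "coset a (approx_square_group v u) = coset b (approx_square_group v u)"
proof (rule coset_eqI)
  obtain \<gamma> where \<gamma>: "u = Fin (\<gamma> + \<gamma>)" using u by (auto simp: even_value_def)
  \<comment> \<open>an element whose square has value \<open>u\<close>, so that \<open>v_square_le_iff\<close> applies to the threshold \<open>u\<close>\<close>
  obtain g where g: "v g = Fin \<gamma>" using v_surj by blast
  have ge: "Fin \<gamma> \<le> v r \<longleftrightarrow> u \<le> v (r\<^sup>2)" for r
    using v_square_le_iff[of g r] by (simp add: g v_square[of g] \<gamma>)
  note cross = two_times_square_gt[OF two refl, of \<gamma>, folded \<gamma>, unfolded ge]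
  show "x + y \<in> approx_square_group v u"
    if xy: "x \<in> approx_square_group v u" "y \<in> approx_square_group v u" for x y
  proof -
    obtain r s where rs: "u \<le> v (r\<^sup>2)" "u < v (x - r\<^sup>2)" "u \<le> v (s\<^sup>2)" "u < v (y - s\<^sup>2)"
      using xy by (auto simp: approx_square_group_iff[OF u])
    have "u < v ((x - r\<^sup>2) + (y - s\<^sup>2) - 2 * (r * s))"
      by (intro v_diff_gt[OF v_add_gt] rs cross)
    moreover have "(x - r\<^sup>2) + (y - s\<^sup>2) - 2 * (r * s) = x + y - (r + s)\<^sup>2"
      by (simp add: power2_eq_square algebra_simps)
    moreover have "u \<le> v ((r + s)\<^sup>2)" using rs by (intro v_square_add_ge) auto
    ultimately show ?thesis unfolding approx_square_group_iff[OF u] by metis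
  qed
  show "- x \<in> approx_square_group v u" if x: "x \<in> approx_square_group v u" for x
  proof -
    obtain r where r: "u \<le> v (r\<^sup>2)" "u < v (x - r\<^sup>2)"
      using x by (auto simp: approx_square_group_iff[OF u])
    have "u < v (- (x - r\<^sup>2) - 2 * (r * r))"
      using r cross by (intro v_diff_gt) (simp_all add: v_uminus del: minus_diff_eq)
    moreover have "- (x - r\<^sup>2) - 2 * (r * r) = - x - r\<^sup>2"
      by (simp add: power2_eq_square)
    ultimately show ?thesis using r unfolding approx_square_group_iff[OF u] by metis
  qed
qed (rule diff)

text \<open>
  The derivative \<open>2 a - 1\<close> of \<open>x\<^sup>2 - x - c\<close> is always a unit, so every approximate root lifts.
  Membership in \<open>R\<^sub>A\<^sub>S\<close> can thus be checked modulo the maximal ideal, where squaring is additive.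
\<close>

lemma artin_schreier_groupI:
  assumes hens: "two_henselian v" and two: "0 < v 2"
    and c: "0 \<le> v c" and a: "0 \<le> v a" and near: "0 < v (a\<^sup>2 - a - c)"
  shows "c \<in> artin_schreier_group v"
proof -
  let ?f = "[:- c, - 1, 1:]"
  have "0 < v (2 * a)" using two a by (rule v_times_gt)
  then have "v (2 * a - 1) = 0"
    using v_diff_ge[of 0 "2 * a" 1] v_diff_gt[of 0 "2 * a" "2 * a - 1"]
    by (force simp: v_one)
  then have der: "v (poly (pderiv ?f) a) = 0"
    by (simp add: pderiv_pCons algebra_simps)
  have "poly ?f a = a\<^sup>2 - a - c" by (simp add: power2_eq_square algebra_simps)
  with near have val: "0 < v (poly ?f a)" by metis
  have "coeff ?f i \<in> val_ring v" for i
    using c by (auto simp: coeff_pCons val_ring_iff v_uminus v_one v_zero split: nat.split)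
  then have monic: "lead_coeff ?f = 1 \<and> degree ?f = 2 \<and> (\<forall>i. coeff ?f i \<in> val_ring v)" by simp
  have "a \<in> val_ring v" using a by (simp add: val_ring_iff)
  with hens[unfolded two_henselian_def, THEN conjunct2, rule_format, OF monic] val der
  obtain b where b: "b \<in> val_ring v" "poly ?f b = 0" by metis
  from b(2) have "c = b\<^sup>2 - b" by (simp add: power2_eq_square algebra_simps)
  with b(1) show ?thesis unfolding artin_schreier_group_def by blast
qed

lemma coset_artin_schreier_eqI:
  assumes hens: "two_henselian v" and two: "0 < v 2"
    and diff: "b - a \<in> (\<lambda>x. 4 * x) ` artin_schreier_group v"
  shows "coset a ((\<lambda>x. 4 * x) ` artin_schreier_group v)
    = coset b ((\<lambda>x. 4 * x) ` artin_schreier_group v)"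
  using diff
proof (rule coset_eqI[rotated 2])
  have add: "c + d \<in> artin_schreier_group v"
    if "c \<in> artin_schreier_group v" "d \<in> artin_schreier_group v" for c d
  proof -
    obtain x y where xy: "0 \<le> v x" "0 \<le> v y" "c = x\<^sup>2 - x" "d = y\<^sup>2 - y"
      using \<open>c \<in> _\<close> \<open>d \<in> _\<close> by (auto simp: artin_schreier_group_def val_ring_iff)
    show ?thesis
    proof (rule artin_schreier_groupI[OF hens two])
      show "0 \<le> v (x + y)" using xy by (intro v_add_ge)
      show "0 \<le> v (c + d)" using xy by (simp add: val_ring_closed power2_eq_square)
      have "(x + y)\<^sup>2 - (x + y) - (c + d) = 2 * (x * y)"
        by (simp add: xy power2_eq_square algebra_simps)
      then show "0 < v ((x + y)\<^sup>2 - (x + y) - (c + d))"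
        using two xy by (simp only:) (intro v_times_gt v_times_ge)
    qed
  qed
  have neg: "- c \<in> artin_schreier_group v" if "c \<in> artin_schreier_group v" for c
  proof -
    obtain x where x: "0 \<le> v x" "c = x\<^sup>2 - x"
      using \<open>c \<in> _\<close> by (auto simp: artin_schreier_group_def val_ring_iff)
    have c: "0 \<le> v c" using x by (simp add: val_ring_closed power2_eq_square)
    show ?thesis
    proof (rule artin_schreier_groupI[OF hens two _ x(1)])
      show "0 \<le> v (- c)" using c by (simp add: v_uminus)
      have "x\<^sup>2 - x - - c = 2 * c" by (simp add: x)
      then show "0 < v (x\<^sup>2 - x - - c)"
        using two c by (simp only:) (intro v_times_gt)
    qed
  qed
  fix x assume "x \<in> (\<lambda>x. 4 * x) ` artin_schreier_group v"
  then obtain c where c: "c \<in> artin_schreier_group v" "x = 4 * c" by blast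
  then have "- x = 4 * - c" "- c \<in> artin_schreier_group v" using neg by simp_all
  then show "- x \<in> (\<lambda>x. 4 * x) ` artin_schreier_group v" by (rule image_eqI)
  fix y assume "y \<in> (\<lambda>x. 4 * x) ` artin_schreier_group v"
  then obtain d where d: "d \<in> artin_schreier_group v" "y = 4 * d" by blast
  then have "x + y = 4 * (c + d)" "c + d \<in> artin_schreier_group v"
    using add c by (simp_all add: distrib_left)
  then show "x + y \<in> (\<lambda>x. 4 * x) ` artin_schreier_group v" by (rule image_eqI)
qed

end

section \<open>Isomorphisms\<close>

lemma lattice_iso_isotropic:
  assumes "lattice_iso v \<alpha> \<beta> \<gamma> \<delta> \<phi>" "0 \<in> lattice v" "isotropic v \<alpha> \<beta>"
  shows "isotropic v \<gamma> \<delta>"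
proof -
  have bij: "bij_betw \<phi> (lattice v) (lattice v)"
    and \<phi>: "\<And>z. z \<in> lattice v \<Longrightarrow> form \<gamma> \<delta> (\<phi> z) (\<phi> z) = form \<alpha> \<beta> z z"
    and add: "\<And>z w. z \<in> lattice v \<Longrightarrow> w \<in> lattice v \<Longrightarrow> \<phi> (z + w) = \<phi> z + \<phi> w"
    using assms(1) by (auto simp: lattice_iso_def)
  obtain z where z: "z \<in> lattice v" "z \<noteq> 0" "form \<alpha> \<beta> z z = 0"
    using assms(3) by (auto simp: isotropic_def)
  have "\<phi> 0 = 0" using add[OF assms(2) assms(2)] by simp
  then have "\<phi> z \<noteq> 0"
    using bij z(1,2) assms(2) by (metis bij_betw_def inj_on_eq_iff)
  moreover have "\<phi> z \<in> lattice v" using bij z(1) by (auto simp: bij_betw_def)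
  ultimately show ?thesis using z \<phi> unfolding isotropic_def by metis
qed

context valuation
begin

lemma lattice_iff: "z \<in> lattice v \<longleftrightarrow> 0 \<le> v (fst z) \<and> 0 \<le> v (snd z)"
  by (cases z) (simp add: lattice_def val_ring_iff)

lemma zero_in_lattice: "0 \<in> lattice v"
  by (simp add: lattice_iff v_zero)

lemma add_in_lattice: "z \<in> lattice v \<Longrightarrow> w \<in> lattice v \<Longrightarrow> z + w \<in> lattice v"
  by (simp add: lattice_iff v_add_ge)

lemma scale_in_lattice: "0 \<le> v r \<Longrightarrow> z \<in> lattice v \<Longrightarrow> scale r z \<in> lattice v"
  by (simp add: lattice_iff scale_def v_times_ge)

lemma isomorphic_lattices_sym:
  assumes "isomorphic_lattices v \<alpha> \<beta> \<gamma> \<delta>"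
  shows "isomorphic_lattices v \<gamma> \<delta> \<alpha> \<beta>"
proof -
  obtain \<phi> where bij: "bij_betw \<phi> (lattice v) (lattice v)"
    and add: "\<And>z w. z \<in> lattice v \<Longrightarrow> w \<in> lattice v \<Longrightarrow> \<phi> (z + w) = \<phi> z + \<phi> w"
    and scl: "\<And>r z. 0 \<le> v r \<Longrightarrow> z \<in> lattice v \<Longrightarrow> \<phi> (scale r z) = scale r (\<phi> z)"
    and frm: "\<And>z w. z \<in> lattice v \<Longrightarrow> w \<in> lattice v \<Longrightarrow>
      form \<gamma> \<delta> (\<phi> z) (\<phi> w) = form \<alpha> \<beta> z w"
    using assms unfolding isomorphic_lattices_def lattice_iso_def val_ring_iff[symmetric]
    by blast
  define \<psi> where "\<psi> = inv_into (lattice v) \<phi>"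
  have bij': "bij_betw \<psi> (lattice v) (lattice v)"
    unfolding \<psi>_def using bij by (rule bij_betw_inv_into)
  have L: "\<psi> z \<in> lattice v" "\<phi> (\<psi> z) = z" if "z \<in> lattice v" for z
    using bij' bij_betw_inv_into_right[OF bij] that by (auto simp: \<psi>_def bij_betw_def)
  have inv: "\<psi> (\<phi> z) = z" if "z \<in> lattice v" for z
    using bij_betw_inv_into_left[OF bij] that by (simp add: \<psi>_def)
  have "\<psi> (z + w) = \<psi> z + \<psi> w" if "z \<in> lattice v" "w \<in> lattice v" for z w
    using inv[OF add_in_lattice[of "\<psi> z" "\<psi> w"]] add[of "\<psi> z" "\<psi> w"] L that by metis
  moreover have "\<psi> (scale r z) = scale r (\<psi> z)" if "0 \<le> v r" "z \<in> lattice v" for r z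
    using inv[OF scale_in_lattice[of r "\<psi> z"]] scl[of r "\<psi> z"] L that by metis
  moreover have "form \<alpha> \<beta> (\<psi> z) (\<psi> w) = form \<gamma> \<delta> z w"
    if "z \<in> lattice v" "w \<in> lattice v" for z w
    using frm[of "\<psi> z" "\<psi> w"] L that by metis
  ultimately have "lattice_iso v \<gamma> \<delta> \<alpha> \<beta> \<psi>"
    using bij' by (simp add: lattice_iso_def val_ring_iff)
  then show ?thesis by (auto simp: isomorphic_lattices_def)
qed

lemma lattice_iso_primitive_snd:
  assumes "lattice_iso v \<alpha> \<beta> \<gamma> \<delta> \<phi>"
  shows "primitive v (\<phi> (0, 1))"
proof -
  have bij: "bij_betw \<phi> (lattice v) (lattice v)"
    and add: "\<And>z w. z \<in> lattice v \<Longrightarrow> w \<in> lattice v \<Longrightarrow> \<phi> (z + w) = \<phi> z + \<phi> w"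
    and scl: "\<And>r z. 0 \<le> v r \<Longrightarrow> z \<in> lattice v \<Longrightarrow> \<phi> (scale r z) = scale r (\<phi> z)"
    using assms by (auto simp: lattice_iso_def val_ring_iff)
  have y: "(0, 1) \<in> lattice v" by (simp add: lattice_iff v_zero v_one)
  have inj: "z = w" if "\<phi> z = \<phi> w" "z \<in> lattice v" "w \<in> lattice v" for z w
    using bij that by (auto simp: bij_betw_def inj_on_def)
  have "\<phi> 0 = 0" using add[OF zero_in_lattice zero_in_lattice] by simp
  then have "\<phi> (0, 1) \<noteq> 0"
    using inj[OF _ y zero_in_lattice] by (auto simp: zero_prod_def)
  moreover have "\<phi> (0, 1) \<in> lattice v" using bij y by (auto simp: bij_betw_def)
  moreover have "w \<in> span1 v (\<phi> (0, 1))"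
    if w: "w \<in> lattice v" and r: "0 \<le> v r" "r \<noteq> 0" and mem: "scale r w \<in> span1 v (\<phi> (0, 1))"
    for w r
  proof -
    obtain w' where w': "w' \<in> lattice v" "w = \<phi> w'"
      using bij w unfolding bij_betw_def by blast
    obtain s where s: "0 \<le> v s" "scale r w = scale s (\<phi> (0, 1))"
      using mem by (auto simp: span1_def val_ring_iff)
    have "\<phi> (scale r w') = \<phi> (scale s (0, 1))"
      using s w' r y by (simp add: scl)
    then have "scale r w' = scale s (0, 1)"
      by (rule inj) (intro scale_in_lattice r s w' y)+
    then have "fst w' = 0" using r by (simp add: scale_def)
    then have "w' = scale (snd w') (0, 1)" by (simp add: scale_def prod_eq_iff)
    then have "w = scale (snd w') (\<phi> (0, 1))"
      using w' y scl[of "snd w'" "(0, 1)"] by (metis lattice_iff)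
    then show ?thesis using w' by (auto simp: span1_def val_ring_iff lattice_iff)
  qed
  ultimately show ?thesis by (auto simp: primitive_def val_ring_iff)
qed

lemma isomorphic_maximal_valuation_le:
  assumes "isomorphic_lattices v \<alpha> \<beta> \<gamma> \<delta>" "maximal_valuation v \<gamma> \<delta>"
  shows "v \<beta> \<le> v \<delta>"
proof -
  obtain \<phi> where \<phi>: "lattice_iso v \<alpha> \<beta> \<gamma> \<delta> \<phi>"
    using assms(1) by (auto simp: isomorphic_lattices_def)
  have "(0, 1) \<in> lattice v" by (simp add: lattice_iff v_zero v_one)
  then have "form \<gamma> \<delta> (\<phi> (0, 1)) (\<phi> (0, 1)) = \<beta>"
    using \<phi> by (simp add: lattice_iso_def) (simp add: form_def)
  then show ?thesis
    using lattice_iso_primitive_snd[OF \<phi>] assms(2) unfolding maximal_valuation_def by metis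
qed

text \<open>
  The pairs \<open>(a, b)\<close> and \<open>(c, d)\<close> are the coordinates of the basis \<open>X, Y\<close>, the preimage of the
  standard basis of \<open>M\<^bsub>\<gamma>,\<delta>\<^esub>\<close>.
\<close>

lemma isomorphic_latticesE:
  assumes "isomorphic_lattices v \<alpha> \<beta> \<gamma> \<delta>"
  obtains a b c d where "0 \<le> v a" "0 \<le> v b" "0 \<le> v c" "0 \<le> v d"
    "\<gamma> = form \<alpha> \<beta> (a, b) (a, b)" "\<delta> = form \<alpha> \<beta> (c, d) (c, d)" "1 = form \<alpha> \<beta> (a, b) (c, d)"
proof -
  obtain \<psi> where \<psi>: "lattice_iso v \<gamma> \<delta> \<alpha> \<beta> \<psi>"
    using isomorphic_lattices_sym[OF assms] by (auto simp: isomorphic_lattices_def)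
  have xy: "(1, 0) \<in> lattice v" "(0, 1) \<in> lattice v" by (simp_all add: lattice_iff v_zero v_one)
  obtain a b where ab: "\<psi> (1, 0) = (a, b)" by (cases "\<psi> (1, 0)")
  obtain c d where cd: "\<psi> (0, 1) = (c, d)" by (cases "\<psi> (0, 1)")
  have "(a, b) \<in> lattice v" "(c, d) \<in> lattice v"
    using \<psi> xy ab[symmetric] cd[symmetric] by (auto simp: lattice_iso_def bij_betw_def)
  moreover have "form \<alpha> \<beta> (\<psi> z) (\<psi> w) = form \<gamma> \<delta> z w"
    if "z \<in> lattice v" "w \<in> lattice v" for z w
    using \<psi> that by (simp add: lattice_iso_def)
  note this[OF xy(1) xy(1)] this[OF xy(2) xy(2)] this[OF xy(1) xy(2)]
  ultimately show ?thesis
    by (intro that[of a b c d]) (simp_all add: ab cd lattice_iff, simp_all add: form_def)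
qed

section \<open>Change of basis\<close>

lemma norm_ge:
  assumes "v \<alpha> \<le> v \<beta>" "v \<alpha> \<le> v 2" "0 \<le> v a" "0 \<le> v b"
  shows "v \<alpha> \<le> v (form \<alpha> \<beta> (a, b) (a, b))"
proof -
  have "form \<alpha> \<beta> (a, b) (a, b) = \<alpha> * (a * a) + 2 * (a * b) + \<beta> * (b * b)"
    by (simp add: form_def algebra_simps)
  then show ?thesis using assms by (simp only:) (intro v_add_ge v_times_ge order_refl)
qed

text \<open>
  If \<open>\<alpha> c\<^sup>2\<close> had value less than \<open>v \<beta>\<close>, then the norm of \<open>c x + d y\<close> could have value at least \<open>v \<beta>\<close>
  only if \<open>\<alpha> c\<^sup>2\<close> is cancelled by \<open>2 c d\<close>. That makes \<open>v (\<alpha> c) \<ge> v 2\<close>, hence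
  \<open>v (\<alpha>\<^sup>2 c\<^sup>2) \<ge> 2 v(2) \<ge> v (\<alpha> \<beta>)\<close>; dividing by \<open>\<alpha>\<close> contradicts the assumption.
\<close>

lemma first_coordinate_bound:
  assumes nz: "\<alpha> \<noteq> 0" and s: "v (\<alpha> * \<beta>) \<le> v 4" and R: "0 \<le> v c" "0 \<le> v d"
    and norm: "v \<beta> \<le> v (form \<alpha> \<beta> (c, d) (c, d))"
  shows "v \<beta> \<le> v (\<alpha> * c\<^sup>2)"
proof (rule ccontr)
  assume "\<not> v \<beta> \<le> v (\<alpha> * c\<^sup>2)"
  then have less: "v (\<alpha> * c\<^sup>2) < v \<beta>" by simp
  then have c: "c \<noteq> 0" by (auto simp: v_zero)
  have "v \<beta> \<le> v (form \<alpha> \<beta> (c, d) (c, d) - \<beta> * (d * d))"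
    using norm R by (intro v_diff_ge v_times_ge) auto
  moreover have "form \<alpha> \<beta> (c, d) (c, d) - \<beta> * (d * d) = c * (\<alpha> * c + 2 * d)"
    by (simp add: form_def algebra_simps)
  ultimately have "v (c * (\<alpha> * c)) < v (c * (\<alpha> * c + 2 * d))"
    using less by (simp add: power2_eq_square algebra_simps)
  then have "v (\<alpha> * c) < v (\<alpha> * c + 2 * d)" by (simp only: v_times_less_cancel[OF c])
  then have "v (2 * d) \<le> v (\<alpha> * c)"
    using v_diff_gt[of "v (\<alpha> * c)" "\<alpha> * c + 2 * d" "2 * d"] by force
  moreover have "v 2 \<le> v (2 * d)" using R by (intro v_times_ge) auto
  ultimately have "v (2\<^sup>2) \<le> v ((\<alpha> * c)\<^sup>2)" unfolding v_square_le_iff by simp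
  then have "v (\<alpha> * \<beta>) \<le> v (\<alpha> * (\<alpha> * c\<^sup>2))"
    using s by (simp add: power2_eq_square algebra_simps)
  then show False using less by (simp add: v_times_le_cancel[OF nz])
qed

text \<open>
  Subtracting \<open>(X, Y) = 1\<close> from the determinant leaves \<open>\<epsilon> = - (\<alpha> a c + \<beta> b d + 2 b c)\<close>. The three terms
  have squares of value at least \<open>v (\<alpha> \<beta>)\<close>, by \<open>first_coordinate_bound\<close>, by \<open>v \<alpha> \<le> v \<beta>\<close> and by
  \<open>v (\<alpha> \<beta>) \<le> 2 v(2)\<close> respectively.
\<close>

lemma change_of_basis:
  assumes nz: "\<alpha> \<noteq> 0" and le: "v \<alpha> \<le> v \<beta>" and s: "v (\<alpha> * \<beta>) \<le> v 4"
    and R: "0 \<le> v a" "0 \<le> v b" "0 \<le> v c" "0 \<le> v d"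
    and \<gamma>: "\<gamma> = form \<alpha> \<beta> (a, b) (a, b)" and \<delta>: "\<delta> = form \<alpha> \<beta> (c, d) (c, d)"
    and one: "1 = form \<alpha> \<beta> (a, b) (c, d)" and norm: "v \<beta> \<le> v \<delta>"
  obtains \<epsilon> where "v (\<alpha> * \<beta>) \<le> v (\<epsilon>\<^sup>2)" "\<gamma> * \<delta> - \<alpha> * \<beta> = (2 * \<epsilon> + \<epsilon>\<^sup>2) * (\<alpha> * \<beta> - 1)"
proof
  define \<epsilon> where "\<epsilon> = - (\<alpha> * c * a + \<beta> * (b * d) + 2 * (b * c))"
  have det: "a * d - b * c = 1 + \<epsilon>"
  proof -
    have "a * d - b * c = form \<alpha> \<beta> (a, b) (c, d) + \<epsilon>"
      by (simp add: form_def \<epsilon>_def algebra_simps)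
    then show ?thesis using one by simp
  qed
  have "\<gamma> * \<delta> - (form \<alpha> \<beta> (a, b) (c, d))\<^sup>2 = (a * d - b * c)\<^sup>2 * (\<alpha> * \<beta> - 1)"
    unfolding \<gamma> \<delta> by (simp add: form_def power2_eq_square algebra_simps)
  then have "\<gamma> * \<delta> = 1 + (1 + \<epsilon>)\<^sup>2 * (\<alpha> * \<beta> - 1)"
    unfolding det one[symmetric] by (simp add: algebra_simps)
  then show "\<gamma> * \<delta> - \<alpha> * \<beta> = (2 * \<epsilon> + \<epsilon>\<^sup>2) * (\<alpha> * \<beta> - 1)"
    by (simp add: power2_eq_square algebra_simps)
  have "v \<beta> \<le> v (\<alpha> * c\<^sup>2)"
    using first_coordinate_bound[OF nz s R(3,4)] norm unfolding \<delta> by blast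
  then have "v (\<alpha> * \<beta>) \<le> v (\<alpha> * (\<alpha> * c\<^sup>2))" by (simp add: v_times_le_cancel[OF nz])
  then have "v (\<alpha> * \<beta>) \<le> v ((\<alpha> * c)\<^sup>2 * a\<^sup>2)"
    using R by (intro v_times_ge) (simp_all add: power2_eq_square algebra_simps val_ring_closed)
  moreover have "v (\<alpha> * \<beta>) \<le> v (\<beta>\<^sup>2)"
    using le by (simp add: v_times v_square add_right_mono)
  then have "v (\<alpha> * \<beta>) \<le> v (\<beta>\<^sup>2 * (b * d)\<^sup>2)"
    using R by (intro v_times_ge) (simp_all only: v_square_nonneg_iff val_ring_closed)
  moreover have "v (\<alpha> * \<beta>) \<le> v (2\<^sup>2 * (b * c)\<^sup>2)"
    using R s by (intro v_times_ge) (simp_all add: v_square_nonneg_iff val_ring_closed)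
  ultimately have "v (\<alpha> * \<beta>) \<le> v ((\<alpha> * c * a + \<beta> * (b * d) + 2 * (b * c))\<^sup>2)"
    by (intro v_square_add_ge) (simp_all only: power_mult_distrib)
  then show "v (\<alpha> * \<beta>) \<le> v (\<epsilon>\<^sup>2)" unfolding \<epsilon>_def power2_minus .
qed

lemma two_times_gt:
  assumes nz: "p \<noteq> 0" and sq: "v p \<le> v (\<epsilon>\<^sup>2)" and less: "v p < v 4"
  shows "v p < v (2 * \<epsilon>)"
proof -
  have "v (p * p) \<le> v (p * \<epsilon>\<^sup>2)" using sq by (simp only: v_times_le_cancel[OF nz])
  moreover have "v (\<epsilon>\<^sup>2 * p) < v (\<epsilon>\<^sup>2 * 4)" if "\<epsilon> \<noteq> 0"
    using less that by (subst v_times_less_cancel) auto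
  ultimately have "v (p\<^sup>2) < v ((2 * \<epsilon>)\<^sup>2)" if "\<epsilon> \<noteq> 0"
    using that by (simp add: power2_eq_square algebra_simps)
  moreover have "v p < Pinf" by (rule v_nonzeroE[OF nz]) simp
  ultimately show ?thesis
    unfolding v_square_less_iff by (cases "\<epsilon> = 0") (simp_all add: v_zero)
qed

section \<open>Invariance\<close>

text \<open>
  The last two bounds hold since the invariant is not defined for \<open>v \<alpha> + v \<beta> > 2 v(2)\<close> unless the
  lattice is isotropic.
\<close>

lemma anisotropic_arf_defined:
  assumes an: "\<not> isotropic v \<alpha> \<beta>" and defd: "arf v \<alpha> \<beta> \<noteq> None" and le: "v \<alpha> \<le> v \<beta>"
  shows "\<alpha> \<noteq> 0" "\<beta> \<noteq> 0" "v (\<alpha> * \<beta>) \<le> v 4" "v \<alpha> \<le> v 2"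
proof -
  have "(1, 0) \<in> lattice v" "(0, 1) \<in> lattice v" by (simp_all add: lattice_iff v_zero v_one)
  then have "form \<alpha> \<beta> (1, 0) (1, 0) \<noteq> 0" "form \<alpha> \<beta> (0, 1) (0, 1) \<noteq> 0"
    using an by (auto simp: isotropic_def zero_prod_def)
  then show "\<alpha> \<noteq> 0" "\<beta> \<noteq> 0" by (simp_all add: form_def)
  show s: "v (\<alpha> * \<beta>) \<le> v 4"
    using an defd by (auto simp: arf_def Let_def v_times v_four split: if_splits)
  have "v (\<alpha>\<^sup>2) \<le> v (\<alpha> * \<beta>)" using le by (simp add: v_times v_square add_left_mono)
  then have "v (\<alpha>\<^sup>2) \<le> v (2\<^sup>2)" using s by simp
  then show "v \<alpha> \<le> v 2" by (simp only: v_square_le_iff)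
qed

text \<open>
  The identity and the bound provided by \<open>change_of_basis\<close> suffice to place \<open>\<gamma> \<delta> - \<alpha> \<beta>\<close> in the
  modulus of each type.
\<close>

lemma arf_eqI:
  assumes hens: "two_henselian v" and two: "0 < v 2"
    and nz: "p \<noteq> 0" and Rp: "0 \<le> v p"
    and p: "p = \<alpha> * \<beta>" and q: "q = \<gamma> * \<delta>"
    and an: "\<not> isotropic v \<alpha> \<beta>" "\<not> isotropic v \<gamma> \<delta>"
    and defd: "arf v \<alpha> \<beta> \<noteq> None"
    and vpq: "v q = v p" and \<epsilon>: "v p \<le> v (\<epsilon>\<^sup>2)"
    and diff: "q - p = (2 * \<epsilon> + \<epsilon>\<^sup>2) * (p - 1)"
  shows "arf v \<alpha> \<beta> = arf v \<gamma> \<delta>"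
proof -
  let ?I = "val_ideal v (v p)" and ?J = "approx_square_group v (v p)"
    and ?E = "(\<lambda>x. 4 * x) ` artin_schreier_group v"
  have A: "arf v \<alpha> \<beta> = (if v p < v 4 \<and> odd_value (v p) then Some (Odd_Arf ?I (coset p ?I))
       else if 0 < v p \<and> v p < v 4 \<and> even_value (v p) then Some (Even_Arf ?J (coset p ?J))
       else if v p = v 4 then Some (Exact_Arf ?E (coset p ?E)) else None)"
    using an by (simp add: arf_def Let_def p v_times v_four)
  have B: "arf v \<gamma> \<delta> = (if v p < v 4 \<and> odd_value (v p) then Some (Odd_Arf ?I (coset q ?I))
       else if 0 < v p \<and> v p < v 4 \<and> even_value (v p) then Some (Even_Arf ?J (coset q ?J))
       else if v p = v 4 then Some (Exact_Arf ?E (coset q ?E)) else None)"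
    using an vpq by (simp add: arf_def Let_def q v_times v_four)
  consider (odd) "v p < v 4" "odd_value (v p)"
    | (even) "0 < v p" "v p < v 4" "\<not> odd_value (v p)" "even_value (v p)"
    | (exact) "\<not> v p < v 4" "v p = v 4"
    using defd unfolding A by (auto split: if_splits)
  then show ?thesis
  proof cases
    case odd
    have "v p \<noteq> v (\<epsilon>\<^sup>2)"
      using odd(2) v_not_Minf[of \<epsilon>] by (cases "v \<epsilon>") (auto simp: odd_value_def v_square)
    then have "v p < v (2 * \<epsilon> + \<epsilon>\<^sup>2)"
      using two_times_gt[OF nz \<epsilon> odd(1)] \<epsilon> by (intro v_add_gt) auto
    moreover have "0 \<le> v (p - 1)" using Rp by (simp add: val_ring_closed v_one)
    ultimately have "q - p \<in> ?I"
      unfolding diff val_ideal_def by (simp add: v_times_gt)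
    then show ?thesis using odd coset_val_ideal_eqI[of q p "v p"] unfolding A B by simp
  next
    case even
    have e: "0 < v (\<epsilon>\<^sup>2)" using even(1) \<epsilon> by simp
    note t = two_times_gt[OF nz \<epsilon> even(2)]
    \<comment> \<open>\<open>q - p\<close> is congruent to \<open>- \<epsilon>\<^sup>2\<close>, hence to \<open>\<epsilon>\<^sup>2\<close>; the term \<open>2 \<epsilon> \<epsilon>\<close> accounts for the change of sign\<close>
    have "v p < v (2 * \<epsilon> * (p - 1) + p * \<epsilon>\<^sup>2 - 2 * \<epsilon> * \<epsilon>)"
    proof (intro v_add_gt v_diff_gt)
      show "v p < v (2 * \<epsilon> * (p - 1))"
        using Rp by (intro v_times_gt[OF t]) (simp add: val_ring_closed v_one)
      show "v p < v (2 * \<epsilon> * \<epsilon>)"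
        using e by (intro v_times_gt[OF t]) (simp add: v_square_pos_iff)
      have "v (p * 1) < v (p * \<epsilon>\<^sup>2)"
        unfolding v_times_less_cancel[OF nz] using e by (simp add: v_one)
      then show "v p < v (p * \<epsilon>\<^sup>2)" by simp
    qed
    moreover have "2 * \<epsilon> * (p - 1) + p * \<epsilon>\<^sup>2 - 2 * \<epsilon> * \<epsilon> = q - p - \<epsilon>\<^sup>2"
      unfolding diff by (simp add: power2_eq_square algebra_simps)
    ultimately have "q - p \<in> ?J"
      using even \<epsilon> by (subst approx_square_group_iff) auto
    then show ?thesis
      using even coset_approx_square_group_eqI[OF two even(4)] unfolding A B by simp
  next
    case exact
    have nz4: "(4::'k) \<noteq> 0" using exact nz v_eq_Pinf_iff by metis
    then have nz2: "(2::'k) \<noteq> 0" by (metis mult_zero_left numeral_Bit0 add_0 mult_2)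
    define \<eta> \<mu> where "\<eta> = \<epsilon> / 2" and "\<mu> = p / 4"
    have \<eta>: "\<epsilon> = 2 * \<eta>" and \<mu>: "p = 4 * \<mu>" using nz2 nz4 by (simp_all add: \<eta>_def \<mu>_def)
    have "v (4 * 1) \<le> v (4 * \<eta>\<^sup>2)"
      using \<epsilon> exact by (simp add: \<eta> power2_eq_square algebra_simps)
    then have R\<eta>: "0 \<le> v \<eta>"
      unfolding v_times_le_cancel[OF nz4] by (simp add: v_one v_square_nonneg_iff)
    have "v (4 * 1) \<le> v (4 * \<mu>)" using exact by (simp add: \<mu>)
    then have R\<mu>: "0 \<le> v \<mu>" unfolding v_times_le_cancel[OF nz4] by (simp add: v_one)
    have R4: "0 \<le> v 4" using v_two_nonneg v_square_nonneg_iff[of 2] by simp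
    define h where "h = \<eta> + \<eta>\<^sup>2"
    have Rh: "0 \<le> v h"
      using R\<eta> by (simp add: h_def power2_eq_square val_ring_closed)
    have "h * (p - 1) \<in> artin_schreier_group v"
    proof (rule artin_schreier_groupI[OF hens two _ R\<eta>])
      show "0 \<le> v (h * (p - 1))"
        using Rh R\<mu> R4 by (simp add: \<mu> val_ring_closed v_one)
      have "\<eta>\<^sup>2 - \<eta> - h * (p - 1) = 2 * (\<eta>\<^sup>2 - 2 * (h * \<mu>))"
        by (simp add: h_def \<mu> algebra_simps)
      moreover have "0 < v (2 * (\<eta>\<^sup>2 - 2 * (h * \<mu>)))"
        using two R\<eta> Rh R\<mu> v_two_nonneg
        by (intro v_times_gt) (simp_all add: val_ring_closed v_square_nonneg_iff)
      ultimately show "0 < v (\<eta>\<^sup>2 - \<eta> - h * (p - 1))" by (simp only:)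
    qed
    moreover have "q - p = 4 * (h * (p - 1))"
      unfolding diff by (simp add: \<eta> h_def power2_eq_square algebra_simps)
    ultimately have "q - p \<in> ?E" by (intro image_eqI)
    then have "coset p ?E = coset q ?E" by (rule coset_artin_schreier_eqI[OF hens two])
    with exact show ?thesis unfolding A B by simp
  qed
qed

end

theorem proposition3p14:
  fixes v :: "'k::field \<Rightarrow> 'g::linordered_ab_group_add extended"
    and \<alpha> \<beta> \<gamma> \<delta> :: 'k
  assumes "valuation v"
    and "two_henselian v"
    and "0 < v 2"
    and "\<alpha> \<in> val_ring v" and "\<beta> \<in> val_ring v" and "\<gamma> \<in> val_ring v" and "\<delta> \<in> val_ring v"
    and "v \<alpha> \<le> v \<beta>" and "v \<gamma> \<le> v \<delta>"
    and "maximal_valuation v \<alpha> \<beta>" and "maximal_valuation v \<gamma> \<delta>"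
    and "arf v \<alpha> \<beta> \<noteq> None" and "arf v \<gamma> \<delta> \<noteq> None"
    and "isomorphic_lattices v \<alpha> \<beta> \<gamma> \<delta>"
  shows "arf v \<alpha> \<beta> = arf v \<gamma> \<delta>"
proof -
  interpret valuation v by fact
  have R: "0 \<le> v \<alpha>" "0 \<le> v \<beta>" using assms(4,5) by (simp_all add: val_ring_iff)
  note iso = assms(14)
  note iso' = isomorphic_lattices_sym[OF iso]
  have iff: "isotropic v \<alpha> \<beta> \<longleftrightarrow> isotropic v \<gamma> \<delta>"
    using iso iso' lattice_iso_isotropic[OF _ zero_in_lattice]
    unfolding isomorphic_lattices_def by blast
  show ?thesis
  proof (cases "isotropic v \<alpha> \<beta>")
    case True
    then show ?thesis using iff by (simp add: arf_def Let_def)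
  next
    case False
    then have an: "\<not> isotropic v \<alpha> \<beta>" "\<not> isotropic v \<gamma> \<delta>" using iff by auto
    note A = anisotropic_arf_defined[OF an(1) assms(12) assms(8)]
    note B = anisotropic_arf_defined[OF an(2) assms(13) assms(9)]
    have \<delta>: "v \<beta> = v \<delta>"
      using isomorphic_maximal_valuation_le iso iso' assms(10,11) by (metis order_antisym)
    obtain a b c d where abcd: "0 \<le> v a" "0 \<le> v b" "0 \<le> v c" "0 \<le> v d"
      "\<gamma> = form \<alpha> \<beta> (a, b) (a, b)" "\<delta> = form \<alpha> \<beta> (c, d) (c, d)"
      "1 = form \<alpha> \<beta> (a, b) (c, d)"
      using iso by (rule isomorphic_latticesE)
    have "v \<alpha> \<le> v \<gamma>" using norm_ge[OF assms(8) A(4) abcd(1,2)] abcd(5) by simp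
    moreover have "v \<gamma> \<le> v \<alpha>"
      using iso' by (rule isomorphic_latticesE) (use norm_ge[OF assms(9) B(4)] in simp)
    ultimately have \<gamma>: "v \<alpha> = v \<gamma>" by simp
    obtain \<epsilon> where \<epsilon>: "v (\<alpha> * \<beta>) \<le> v (\<epsilon>\<^sup>2)"
      "\<gamma> * \<delta> - \<alpha> * \<beta> = (2 * \<epsilon> + \<epsilon>\<^sup>2) * (\<alpha> * \<beta> - 1)"
      using change_of_basis[OF A(1) assms(8) A(3) abcd] \<delta> by auto
    show ?thesis
      using A val_ring_closed(3)[OF R] \<gamma> \<delta>
      by (intro arf_eqI[OF assms(2,3) _ _ refl refl an assms(12) _ \<epsilon>])
        (simp_all add: v_times)
  qed
qed

end
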